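(* Let $\pi=(d_1,\dots,d_n)$ be the degree sequence of a tree with $d_1\ge d_2\ge\cdots\ge d_k\ge 2$ and $d_{k+1}=\cdots=d_n=1$, where $k\ge 3$. If $C(z_1,\dots,z_k)$ is a maximum optimal caterpillar in $\mathcal{C}_\pi$ (i.e. it maximizes $\varphi$ over $\mathcal{C}_\pi$), then there exists an integer $t$ with $1\le t\le k-1$ such that $$z_1\le z_2\le\cdots\le z_{t-1}<z_t\quad\text{and}\quad z_t\ge z_{t+1}\ge\cdots\ge z_k.$$
   Context: A subtree of a tree is a nonempty connected subgraph; $\varphi(T)$ is the number of nonempty subtrees of $T$. A caterpillar is a tree containing a path such that every vertex not on the path is adjacent to a vertex on the path; $\mathcal{C}_\pi$ is the set of caterpillars with degree sequence $\pi$. For a permutation $(z_1,\dots,z_k)$ of $(d_1-2,\dots,d_k-2)$, $C(z_1,\dots,z_k)$ is the caterpillar obtained from a path $v_0v_1\cdots v_kv_{k+1}$ by attaching $z_j$ new pendant vertices to $v_j$ for $j=1,\dots,k$; every member of $\mathcal{C}_\pi$ is of this form. *)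

theory Defs
  imports "Graph_Theory.Graph_Theory" "HOL-Library.Multiset" "HOL-Combinatorics.Permutations"
begin

text \<open>
  A finite simple undirected graph is a \<^locale>\<open>pair_graph\<close>: a finite, loop-free
  digraph with a symmetric set of arcs, so that an undirected edge is a pair of opposite arcs.
\<close>

text \<open>
  The library predicate \<^const>\<open>tree\<close> is unsuitable for symmetric digraphs, because
  \<^const>\<open>pre_digraph.cycle\<close> counts going forth and back along an edge as a cycle (of length 2).
  In a simple graph the genuine cycles are exactly those of length at least 3.
\<close>

definition is_tree :: "'a pair_pre_digraph \<Rightarrow> bool" where
  "is_tree T \<longleftrightarrow> pair_graph T \<and> Digraph_Component.connected (with_proj T) \<and>
     \<not> (\<exists>p. pre_digraph.cycle (with_proj T) p \<and> 3 \<le> length p)"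

text \<open>
  Requiring \<^term>\<open>pair_graph H\<close> makes \<open>H\<close> a subgraph in the undirected sense (each edge is kept or
  dropped with both its arcs). The library's \<^const>\<open>Digraph_Component.connected\<close> excludes the
  graph without vertices.
\<close>

definition subtrees :: "'a pair_pre_digraph \<Rightarrow> 'a pair_pre_digraph set" where
  "subtrees T = {H. pair_graph H \<and> subgraph (with_proj H) (with_proj T) \<and>
     Digraph_Component.connected (with_proj H)}"

definition num_subtrees :: "'a pair_pre_digraph \<Rightarrow> nat" where
  "num_subtrees T = card (subtrees T)"

text \<open>In a symmetric simple digraph the out-degree is the degree of the undirected graph.\<close>

definition has_degree_sequence :: "'a pair_pre_digraph \<Rightarrow> nat list \<Rightarrow> bool" where
  "has_degree_sequence G ds \<longleftrightarrow>
     mset ds = image_mset (out_degree (with_proj G)) (mset_set (pverts G))"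

definition is_caterpillar :: "'a pair_pre_digraph \<Rightarrow> bool" where
  "is_caterpillar T \<longleftrightarrow> is_tree T \<and>
     (\<exists>p. vpath p (with_proj T) \<and> (\<forall>u \<in> pverts T - set p. \<exists>w \<in> set p. (u, w) \<in> parcs T))"

text \<open>
  The vertices are taken from \<open>nat \<times> nat\<close>; as this type is infinite, every finite graph has an
  isomorphic copy there.
\<close>

definition caterpillars :: "nat list \<Rightarrow> (nat \<times> nat) pair_pre_digraph set" where
  "caterpillars ds = {T. is_caterpillar T \<and> has_degree_sequence T ds}"

text \<open>
  The caterpillar \<open>C(z\<^sub>1, \<dots>, z\<^sub>k)\<close>: the path vertex \<open>v\<^sub>j\<close> is \<open>(j, 0)\<close> for \<open>0 \<le> j \<le> k + 1\<close>, and the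
  pendant vertices attached to \<open>v\<^sub>j\<close> are \<open>(j, 1), \<dots>, (j, z\<^sub>j)\<close> for \<open>1 \<le> j \<le> k\<close>.
\<close>

definition cat_edges :: "nat \<Rightarrow> (nat \<Rightarrow> nat) \<Rightarrow> ((nat \<times> nat) \<times> (nat \<times> nat)) set" where
  "cat_edges k z = {((j, 0), (j + 1, 0)) | j. j \<le> k} \<union>
     {((j, 0), (j, i)) | j i. 1 \<le> j \<and> j \<le> k \<and> 1 \<le> i \<and> i \<le> z j}"

definition cat :: "nat \<Rightarrow> (nat \<Rightarrow> nat) \<Rightarrow> (nat \<times> nat) pair_pre_digraph" where
  "cat k z = \<lparr> pverts = {(j, 0) | j. j \<le> k + 1} \<union>
                 {(j, i) | j i. 1 \<le> j \<and> j \<le> k \<and> 1 \<le> i \<and> i \<le> z j},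
               parcs = cat_edges k z \<union> (cat_edges k z)\<inverse> \<rparr>"

definition maximum_optimal_caterpillar ::
    "nat list \<Rightarrow> (nat \<times> nat) pair_pre_digraph \<Rightarrow> bool" where
  "maximum_optimal_caterpillar ds T \<longleftrightarrow>
     T \<in> caterpillars ds \<and> (\<forall>T' \<in> caterpillars ds. num_subtrees T' \<le> num_subtrees T)"

end

theory Submission
  imports Defs
begin

text \<open>
  Give the spine vertex \<open>v\<^sub>j\<close> the weight \<open>y\<^sub>j = 2 ^ z\<^sub>j\<close> (and \<open>y\<^sub>0 = y\<^sub>k\<^sub>+\<^sub>1 = 1\<close>). A subtree is either a single
  pendant vertex or an interval of the spine with an arbitrary set of pendant vertices attached to it,
  so \<open>\<phi>\<close> is the number of pendant vertices plus the sum over all intervals of the product of their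
  weights. Let \<open>l\<^sub>p\<close> and \<open>r\<^sub>p\<close> be the sums of these products over the intervals ending immediately before
  \<open>p\<close> and starting immediately after \<open>p\<close>. Exchanging \<open>z\<^sub>p\<close> and \<open>z\<^sub>p\<^sub>+\<^sub>1\<close> changes \<open>\<phi>\<close> by
  \<open>(y\<^sub>p\<^sub>+\<^sub>1 - y\<^sub>p) (l\<^sub>p - r\<^sub>p\<^sub>+\<^sub>1)\<close>. In an optimal caterpillar the sign of \<open>l\<^sub>p - r\<^sub>p\<^sub>+\<^sub>1\<close>, which increases strictly
  with \<open>p\<close>, therefore decides the order of \<open>z\<^sub>p\<close> and \<open>z\<^sub>p\<^sub>+\<^sub>1\<close>, and \<open>t\<close> can be taken as the least index from
  which \<open>z\<close> is nonincreasing. As \<open>l\<^sub>k\<^sub>-\<^sub>1 > l\<^sub>1 = 1 = r\<^sub>k\<close>, this index is at most \<open>k - 1\<close>.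
\<close>

subsection \<open>The subtrees of a caterpillar\<close>

text \<open>The arcs already form a symmetric set and never leave the vertex set, so neither the
  symmetric closure nor the restriction of paths to vertices matters when starting at a
  vertex.\<close>

lemma connected_pair_graph_iff:
  assumes "pair_graph H"
  shows "Digraph_Component.connected (with_proj H) \<longleftrightarrow>
    pverts H \<noteq> {} \<and> (\<forall>u\<in>pverts H. \<forall>v\<in>pverts H. (u, v) \<in> (parcs H)\<^sup>*)"
proof -
  interpret pair_graph H by fact
  have sym: "(parcs H)\<^sup>s = parcs H"
    unfolding symcl_def using arcs_symmetric by auto
  have "(u, v) \<in> rtrancl_on (pverts H) (parcs H) \<longleftrightarrow> (u, v) \<in> (parcs H)\<^sup>*"
    if "u \<in> pverts H" for u v
  proof
    show "(u, v) \<in> (parcs H)\<^sup>*" if "(u, v) \<in> rtrancl_on (pverts H) (parcs H)"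
      using that by (rule rtrancl_on_rtranclI)
    show "(u, v) \<in> rtrancl_on (pverts H) (parcs H)" if "(u, v) \<in> (parcs H)\<^sup>*"
      using that
    proof induction
      case base then show ?case using \<open>u \<in> pverts H\<close> by simp
    next
      case (step v w)
      then show ?case using in_arcsD2 by (blast intro: rtrancl_on_into_rtrancl_on)
    qed
  qed
  then show ?thesis by (simp add: connected_conv sym)
qed

definition spine :: "nat \<Rightarrow> nat \<Rightarrow> (nat \<times> nat) set" where
  "spine a b = {a..b} \<times> {0}"

text \<open>Intersecting with \<open>{1..k}\<close> lets \<open>a\<close> and \<open>b\<close> range
  over \<open>0..k + 1\<close>: the two ends of the spine carry no pendant vertices, whatever
  \<open>z\<close> is there.\<close>

definition leaves :: "nat \<Rightarrow> (nat \<Rightarrow> nat) \<Rightarrow> nat \<Rightarrow> nat \<Rightarrow> (nat \<times> nat) set" where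
  "leaves k z a b = (SIGMA j:{a..b} \<inter> {1..k}. {1..z j})"

definition subtree_verts :: "nat \<Rightarrow> (nat \<Rightarrow> nat) \<Rightarrow> (nat \<times> nat) set set" where
  "subtree_verts k z = (\<lambda>v. {v}) ` leaves k z 1 k \<union>
     {spine a b \<union> L | a b L. a \<le> b \<and> b \<le> k + 1 \<and> L \<subseteq> leaves k z a b}"

text \<open>Every subtree turns out to be induced, so counting subtrees becomes counting the vertex
  sets in \<open>subtree_verts\<close>.\<close>

definition cat_induced :: "nat \<Rightarrow> (nat \<Rightarrow> nat) \<Rightarrow> (nat \<times> nat) set \<Rightarrow> (nat \<times> nat) pair_pre_digraph" where
  "cat_induced k z S = \<lparr> pverts = S, parcs = parcs (cat k z) \<inter> S \<times> S \<rparr>"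

lemma pverts_cat: "pverts (cat k z) = spine 0 (k + 1) \<union> leaves k z 0 (k + 1)"
  by (auto simp: cat_def spine_def leaves_def)

lemma finite_leaves [simp]: "finite (leaves k z a b)"
  by (simp add: leaves_def)

lemma cat_edges_iff: "((a, i), (b, j)) \<in> cat_edges k z \<longleftrightarrow>
    i = 0 \<and> (j = 0 \<and> b = a + 1 \<and> a \<le> k \<or> b = a \<and> 1 \<le> a \<and> a \<le> k \<and> 1 \<le> j \<and> j \<le> z a)"
  by (auto simp: cat_edges_def)

lemma parcs_cat: "parcs (cat k z) = cat_edges k z \<union> (cat_edges k z)\<inverse>"
  by (simp add: cat_def)

lemma pair_graph_cat_induced:
  assumes "S \<subseteq> pverts (cat k z)"
  shows "pair_graph (cat_induced k z S)"
proof -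
  have "finite (pverts (cat k z))"
    by (simp add: pverts_cat spine_def)
  with assms have "finite S" by (rule finite_subset)
  then show ?thesis
    by unfold_locales
      (auto simp: cat_induced_def parcs_cat cat_edges_iff symmetric_def intro!: symI)
qed

lemma cat_eq_induced: "cat k z = cat_induced k z (pverts (cat k z))"
proof -
  have "parcs (cat k z) \<subseteq> pverts (cat k z) \<times> pverts (cat k z)"
    by (auto simp: pverts_cat parcs_cat cat_edges_iff spine_def leaves_def)
  then show ?thesis
    unfolding cat_induced_def by (intro pair_pre_digraph.equality) auto
qed

lemma pair_graph_cat: "pair_graph (cat k z)"
  using pair_graph_cat_induced[OF order_refl, of k z] by (simp flip: cat_eq_induced)

lemma subtree_verts_subset:
  assumes "S \<in> subtree_verts k z"
  shows "S \<subseteq> pverts (cat k z)"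
  using assms by (auto simp: subtree_verts_def pverts_cat spine_def leaves_def)

text \<open>In the interval case the left end \<open>(a, 0)\<close> serves as a root: each vertex is
  reached along the spine and possibly one pendant edge, and symmetry of the arcs joins any two
  vertices through the root.\<close>

lemma connected_cat_induced:
  assumes "S \<in> subtree_verts k z"
  shows "Digraph_Component.connected (with_proj (cat_induced k z S))"
proof -
  let ?H = "cat_induced k z S"
  have pg: "pair_graph ?H"
    by (intro pair_graph_cat_induced subtree_verts_subset assms)
  interpret pair_graph ?H by (fact pg)
  consider v where "S = {v}" 
    | a b L where "S = spine a b \<union> L" "a \<le> b" "b \<le> k + 1" "L \<subseteq> leaves k z a b"
    using assms by (auto simp: subtree_verts_def)
  then show ?thesis
  proof cases
    case 1
    then show ?thesis
      using connected_pair_graph_iff[OF pg] by (simp add: cat_induced_def)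
  next
    case 2
    have spine: "((a, 0), (a + j, 0)) \<in> (parcs ?H)\<^sup>*" if "a + j \<le> b" for j
      using that
    proof (induction j)
      case (Suc j)
      then have "((a + j, 0), (a + Suc j, 0)) \<in> parcs ?H"
        using 2 by (auto simp: cat_induced_def parcs_cat cat_edges_iff spine_def)
      moreover have "((a, 0), (a + j, 0)) \<in> (parcs ?H)\<^sup>*" using Suc by simp
      ultimately show ?case by (rule rtrancl_into_rtrancl[rotated])
    qed simp
    have from_root: "((a, 0), v) \<in> (parcs ?H)\<^sup>*" if "v \<in> S" for v
    proof (cases v)
      case (Pair j i)
      with that 2 have j: "a \<le> j" "j \<le> b" by (auto simp: spine_def leaves_def)
      then have *: "((a, 0), (j, 0)) \<in> (parcs ?H)\<^sup>*" using spine[of "j - a"] by simp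
      show ?thesis
      proof (cases "i = 0")
        case False
        then have "((j, 0), (j, i)) \<in> parcs ?H"
          using 2 that Pair j
          by (auto simp: cat_induced_def parcs_cat cat_edges_iff spine_def leaves_def)
        with * Pair show ?thesis by (simp add: rtrancl.rtrancl_into_rtrancl)
      qed (use * Pair in simp)
    qed
    have "sym ((parcs ?H)\<^sup>*)"
      using arcs_symmetric by (intro sym_rtrancl symI) auto
    then have "(u, v) \<in> (parcs ?H)\<^sup>*" if "u \<in> S" "v \<in> S" for u v
      using from_root[OF that(1)] from_root[OF that(2)] by (meson rtrancl_trans symD)
    moreover have "pverts ?H = S" "S \<noteq> {}"
      using 2 by (auto simp: cat_induced_def spine_def)
    ultimately show ?thesis
      using connected_pair_graph_iff[OF pg] by simp
  qed
qed

text \<open>Used with \<open>X\<close> as one side of a cut: if the only arc leaving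
  \<open>X\<close> were missing, the whole graph would lie in \<open>X\<close>.\<close>

lemma connected_closed_set:
  assumes "pair_graph H" "Digraph_Component.connected (with_proj H)"
    and "u \<in> pverts H" "u \<in> X" "\<And>v w. v \<in> X \<Longrightarrow> (v, w) \<in> parcs H \<Longrightarrow> w \<in> X"
  shows "pverts H \<subseteq> X"
proof
  fix v assume "v \<in> pverts H"
  with assms have "(u, v) \<in> (parcs H)\<^sup>*" by (simp add: connected_pair_graph_iff)
  then show "v \<in> X" using assms(4,5) by induction auto
qed

text \<open>Every edge of a caterpillar is a bridge. A connected subgraph with vertices on both
  sides must contain it, which makes the subgraph induced and its spine part an interval.\<close>

lemma subtree_of_cat:
  assumes "H \<in> subtrees (cat k z)"
  shows "pverts H \<in> subtree_verts k z \<and> H = cat_induced k z (pverts H)"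
proof -
  have pg: "pair_graph H" and conn: "Digraph_Component.connected (with_proj H)"
    and verts: "pverts H \<subseteq> pverts (cat k z)" and arcs: "parcs H \<subseteq> parcs (cat k z)"
    using assms by (auto simp: subtrees_def subgraph_def)
  interpret pair_graph H by (fact pg)
  have ne: "pverts H \<noteq> {}" using conn pg by (simp add: connected_pair_graph_iff)
  note closed = connected_closed_set[OF pg conn]
  have leaf_arc: "((j, 0), (j, i)) \<in> parcs H" if "(j, i) \<in> pverts H" "i \<noteq> 0" "pverts H \<noteq> {(j, i)}" for i j
  proof (rule ccontr)
    assume no: "((j, 0), (j, i)) \<notin> parcs H"
    have "pverts H \<subseteq> {(j, i)}"
    proof (rule closed[OF that(1)])
      fix v w assume "v \<in> {(j, i)}" "(v, w) \<in> parcs H"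
      with arcs no arcs_symmetric \<open>i \<noteq> 0\<close> show "w \<in> {(j, i)}"
        by (cases w) (fastforce simp: parcs_cat cat_edges_iff)
    qed simp
    with that ne show False by auto
  qed
  \<comment> \<open>Without this arc the positions up to \<open>j\<close> would be closed under
    arcs, and the vertex at position \<open>b > j\<close> could not be reached.\<close>
  have spine_arc: "((j, 0), (j + 1, 0)) \<in> parcs H"
    if "(a, i) \<in> pverts H" "(b, i') \<in> pverts H" "a \<le> j" "j < b" for a b i i' j
  proof (rule ccontr)
    assume no: "((j, 0), (j + 1, 0)) \<notin> parcs H"
    have "pverts H \<subseteq> {..j} \<times> UNIV"
    proof (rule closed[OF that(1)])
      fix v w assume "v \<in> {..j} \<times> (UNIV :: nat set)" "(v, w) \<in> parcs H"
      moreover obtain a i b i' where vw: "v = (a, i)" "w = (b, i')" by (cases v; cases w) auto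
      ultimately have "a \<le> j" "((a, i), (b, i')) \<in> parcs (cat k z)" and "b = a + 1 \<Longrightarrow> i = 0 \<Longrightarrow> i' = 0 \<Longrightarrow> a \<noteq> j"
        using arcs no by auto
      then show "w \<in> {..j} \<times> UNIV"
        unfolding vw by (auto simp: parcs_cat cat_edges_iff)
    qed (use that in simp)
    with that show False by auto
  qed
  have ind: "H = cat_induced k z (pverts H)"
  proof -
    have "parcs (cat k z) \<inter> pverts H \<times> pverts H \<subseteq> parcs H"
    proof clarify
      fix a i b j assume *: "((a, i), (b, j)) \<in> parcs (cat k z)" "(a, i) \<in> pverts H" "(b, j) \<in> pverts H"
      have E: "((a, i), (b, j)) \<in> parcs H"
        if e: "((a, i), (b, j)) \<in> cat_edges k z" and v: "(a, i) \<in> pverts H" "(b, j) \<in> pverts H" for a i b j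
      proof -
        from e consider "i = 0" "j = 0" "b = a + 1" | "i = 0" "b = a" "j \<noteq> 0"
          by (auto simp: cat_edges_iff)
        then show ?thesis
        proof cases
          case 1 then show ?thesis using spine_arc[OF v, of a] by simp
        next
          case 2
          then show ?thesis using leaf_arc[of a j] v by (metis prod.inject singletonD)
        qed
      qed
      from * show "((a, i), (b, j)) \<in> parcs H"
        unfolding parcs_cat using E arcs_symmetric by blast
    qed
    moreover have "parcs H \<subseteq> pverts H \<times> pverts H" using in_arcsD1 in_arcsD2 by auto
    ultimately show ?thesis using arcs
      unfolding cat_induced_def by (intro pair_pre_digraph.equality) auto
  qed
  have "pverts H \<in> subtree_verts k z"
  proof (cases "\<exists>v\<in>leaves k z 1 k. pverts H = {v}")
    case True
    then show ?thesis by (auto simp: subtree_verts_def)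
  next
    case False
    let ?A = "{j. (j, 0) \<in> pverts H}"
    \<comment> \<open>With single pendant vertices excluded, a pendant vertex of \<open>H\<close>
      brings its spine vertex along, so \<open>?A\<close> is nonempty and its extremes bound all of
      \<open>H\<close>.\<close>
    have base: "(j, 0) \<in> pverts H" if "(j, i) \<in> pverts H" for i j
    proof (cases "i = 0")
      case False
      with that verts have "(j, i) \<in> leaves k z 1 k"
        by (auto simp: pverts_cat spine_def leaves_def)
      with \<open>\<not> (\<exists>v\<in>leaves k z 1 k. pverts H = {v})\<close> have "pverts H \<noteq> {(j, i)}" by auto
      with leaf_arc that False in_arcsD1 show ?thesis by blast
    qed (use that in simp)
    have "?A \<noteq> {}" using ne base by auto
    have A: "?A \<subseteq> {..k + 1}" using verts by (auto simp: pverts_cat spine_def leaves_def)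
    have "finite ?A" using A finite_subset by blast
    obtain a b where a: "(a, 0) \<in> pverts H" and b: "(b, 0) \<in> pverts H"
      and bounds: "\<And>j i. (j, i) \<in> pverts H \<Longrightarrow> a \<le> j \<and> j \<le> b"
    proof
      show "(Min ?A, 0) \<in> pverts H" "(Max ?A, 0) \<in> pverts H"
        using Min_in[OF \<open>finite ?A\<close> \<open>?A \<noteq> {}\<close>] Max_in[OF \<open>finite ?A\<close> \<open>?A \<noteq> {}\<close>] by auto
      show "Min ?A \<le> j \<and> j \<le> Max ?A" if "(j, i) \<in> pverts H" for i j
        using base[OF that] \<open>finite ?A\<close> by simp
    qed
    have "(j, 0) \<in> pverts H" if "a \<le> j" "j \<le> b" for j
    proof (cases "j = b")
      case False
      with that(2) have "j < b" by linarith
      from spine_arc[OF a b that(1) this] show ?thesis by (rule in_arcsD1)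
    qed (use b in simp)
    then have "spine a b \<subseteq> pverts H" by (auto simp: spine_def)
    moreover have "pverts H - spine a b \<subseteq> leaves k z a b"
    proof clarify
      fix j i assume *: "(j, i) \<in> pverts H" "(j, i) \<notin> spine a b"
      with bounds[OF *(1)] verts show "(j, i) \<in> leaves k z a b"
        by (auto simp: pverts_cat spine_def leaves_def)
    qed
    moreover have "a \<le> b" "b \<le> k + 1" using bounds[OF a] b A by auto
    moreover have "pverts H = spine a b \<union> (pverts H - spine a b)"
      using calculation(1) by auto
    ultimately show ?thesis unfolding subtree_verts_def by blast
  qed
  with ind show ?thesis by simp
qed

lemma subtrees_cat: "subtrees (cat k z) = cat_induced k z ` subtree_verts k z"
proof (intro equalityI subsetI)
  fix H assume "H \<in> subtrees (cat k z)"
  then show "H \<in> cat_induced k z ` subtree_verts k z"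
    using subtree_of_cat by blast
next
  fix H assume "H \<in> cat_induced k z ` subtree_verts k z"
  then obtain S where S: "S \<in> subtree_verts k z" and H: "H = cat_induced k z S" by auto
  interpret C: pair_graph "cat k z" by (rule pair_graph_cat)
  interpret pair_graph H
    unfolding H by (intro pair_graph_cat_induced subtree_verts_subset S)
  have "subgraph (with_proj H) (with_proj (cat k z))"
    using subtree_verts_subset[OF S]
    by (intro subgraphI C.wf_digraph_axioms wf_digraph_axioms compatibleI_with_proj)
      (auto simp: H cat_induced_def)
  then show "H \<in> subtrees (cat k z)"
    using connected_cat_induced[OF S] pair_graph_axioms by (simp add: subtrees_def H)
qed

subsection \<open>Permuted caterpillars have the same degree sequence\<close>

lemma pcas_nth:
  assumes "pcas u p v" "p \<noteq> []"
  shows "fst (p ! 0) = u \<and> snd (p ! (length p - 1)) = v \<and>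
    (\<forall>i. Suc i < length p \<longrightarrow> fst (p ! Suc i) = snd (p ! i))"
  using assms
proof (induction p arbitrary: u)
  case (Cons e p)
  show ?case
  proof (cases "p = []")
    case False
    with Cons have IH: "fst (p ! 0) = snd e" "snd (p ! (length p - 1)) = v"
      "\<And>i. Suc i < length p \<Longrightarrow> fst (p ! Suc i) = snd (p ! i)" by auto
    have "fst ((e # p) ! Suc i) = snd ((e # p) ! i)" if "Suc i < length (e # p)" for i
      using IH that by (cases i) auto
    with False Cons.prems IH(2) show ?thesis by simp
  qed (use Cons.prems in simp)
qed simp

text \<open>On the vertices of the caterpillar this is the distance from \<open>(0, 0)\<close>, that
  is, the depth in the tree rooted there; the next lemma is the uniqueness of the parent.\<close>

definition height :: "nat \<times> nat \<Rightarrow> nat" where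
  "height v = (if snd v = 0 then fst v else fst v + 1)"

lemma lower_neighbour_unique:
  assumes "(x, y) \<in> parcs (cat k z)" "(y, w) \<in> parcs (cat k z)"
    and "height x \<le> height y" "height w \<le> height y"
  shows "x = w"
  using assms
  by (cases x; cases y; cases w) (auto simp: parcs_cat cat_edges_iff height_def split: if_splits)

text \<open>A vertex of maximal height on a cycle of length at least 3 would have two different lower neighbours.\<close>

lemma cat_acyclic:
  assumes "pre_digraph.cycle (with_proj (cat k z)) p"
  shows "length p < 3"
proof (rule ccontr)
  assume "\<not> length p < 3"
  then have m: "3 \<le> length p" by simp
  define m where "m = length p"
  interpret pair_graph "cat k z" by (rule pair_graph_cat)
  obtain u where u: "awalk u p u" "distinct (tl (pawalk_verts u p))" "p \<noteq> []"
    using assms by (auto simp: cycle_def)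
  then have arcs: "set p \<subseteq> parcs (cat k z)" and walk: "pcas u p u" by (auto simp: awalk_def)
  \<comment> \<open>The vertices after the first are the heads of the arcs, so the cycle condition
    says that these heads are distinct.\<close>
  have "tl (pawalk_verts u p) = map snd p" if "pcas u p v" for u v p
    using that
  proof (induction p arbitrary: u)
    case (Cons e p)
    then show ?case by (cases p) auto
  qed simp
  with u walk have dist: "distinct (map snd p)" by metis
  have nxt: "fst (p ! (Suc i mod m)) = snd (p ! i)" if "i < m" for i
  proof (cases "Suc i = m")
    case True
    then have "i = length p - 1" by (simp add: m_def)
    with True show ?thesis using pcas_nth[OF walk \<open>p \<noteq> []\<close>] by simp
  next
    case False
    with that show ?thesis using pcas_nth[OF walk \<open>p \<noteq> []\<close>] by (simp add: m_def)
  qed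
  obtain i where i: "i < m" "\<And>j. j < m \<Longrightarrow> height (snd (p ! j)) \<le> height (snd (p ! i))"
  proof -
    let ?A = "(\<lambda>j. height (snd (p ! j))) ` {..<m}"
    have "0 < m" using m unfolding m_def by linarith
    then have "?A \<noteq> {}" by auto
    then have "Max ?A \<in> ?A" by (intro Max_in) auto
    then obtain i where i: "i < m" "Max ?A = height (snd (p ! i))" by auto
    have "height (snd (p ! j)) \<le> Max ?A" if "j < m" for j using that by simp
    then show ?thesis using i that[of i] by simp
  qed
  \<comment> \<open>\<open>l\<close> and \<open>j\<close> are the cyclic predecessor and successor
    of \<open>i\<close>; they differ because the length is at least 3. The heads at \<open>l\<close>
    and \<open>j\<close> are the two neighbours of the highest vertex on the cycle.\<close>
  define l where "l = (if i = 0 then m - 1 else i - 1)"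
  define j where "j = Suc i mod m"
  have l: "l < m" "Suc l mod m = i" and j: "j < m" "l \<noteq> j"
    using i(1) m by (auto simp: l_def j_def m_def mod_Suc)
  have "(fst (p ! i), snd (p ! i)) \<in> parcs (cat k z)" "(fst (p ! j), snd (p ! j)) \<in> parcs (cat k z)"
    using arcs i(1) j(1) by (auto simp: m_def)
  moreover have "fst (p ! i) = snd (p ! l)" "fst (p ! j) = snd (p ! i)"
    using nxt[OF l(1)] nxt[OF i(1)] l(2) by (auto simp: j_def)
  ultimately have "snd (p ! l) = snd (p ! j)"
    using lower_neighbour_unique i(2)[OF l(1)] i(2)[OF j(1)] by metis
  with dist l(1) j show False
    by (auto simp: distinct_conv_nth m_def)
qed

section \<open>Each \<open>cat k z\<close> is a caterpillar\<close>

lemma full_subtree_verts: "pverts (cat k z) \<in> subtree_verts k z"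
  unfolding pverts_cat subtree_verts_def by blast

lemma is_tree_cat: "is_tree (cat k z)"
  using pair_graph_cat connected_cat_induced[OF full_subtree_verts, of k z] cat_acyclic
  unfolding is_tree_def cat_eq_induced[symmetric] by (meson not_le)

lemma vpath_spine: "vpath (map (\<lambda>j. (j, 0)) [0..<k + 2]) (with_proj (cat k z))"
proof -
  have arcs: "set (vwalk_arcs (map (\<lambda>j. (j, 0 :: nat)) [0..<Suc m])) \<subseteq> parcs (cat k z)" if "m \<le> k + 1" for m
    using that
  proof (induction m)
    case (Suc m)
    have "vwalk_arcs (map (\<lambda>j. (j, 0 :: nat)) [0..<Suc (Suc m)]) =
      vwalk_arcs (map (\<lambda>j. (j, 0)) [0..<Suc m]) @ [((m, 0), (Suc m, 0))]"
      using vwalk_arcs_append[of "map (\<lambda>j. (j, 0 :: nat)) [0..<Suc m]" "[(Suc m, 0)]"]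
      by (simp add: upt_Suc_append[of 0 "Suc m"] last_map del: upt_Suc)
    with Suc show ?case by (auto simp: parcs_cat cat_edges_iff)
  qed simp
  have "distinct (map (\<lambda>j. (j, 0 :: nat)) [0..<k + 2])"
    by (simp add: distinct_map inj_on_def del: upt_Suc)
  then show ?thesis
    using arcs[of "k + 1"]
    by (auto simp: vpath_def vwalk_def pverts_cat spine_def simp del: upt_Suc)
qed

lemma is_caterpillar_cat: "is_caterpillar (cat k z)"
  unfolding is_caterpillar_def
proof (rule conjI[OF is_tree_cat], rule exI, rule conjI[OF vpath_spine], rule ballI)
  fix u assume "u \<in> pverts (cat k z) - set (map (\<lambda>j. (j, 0)) [0..<k + 2])"
  then have "u \<in> leaves k z 0 (k + 1)"
    by (auto simp: pverts_cat spine_def)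
  then have "(fst u, 0) \<in> set (map (\<lambda>j. (j, 0)) [0..<k + 2])" "(u, (fst u, 0)) \<in> parcs (cat k z)"
    by (auto simp: leaves_def parcs_cat cat_edges_iff)
  then show "\<exists>w\<in>set (map (\<lambda>j. (j, 0)) [0..<k + 2]). (u, w) \<in> parcs (cat k z)" by blast
qed

section \<open>Degrees and their invariance under permuting \<open>z\<close>\<close>

lemma out_degree_cat:
  assumes "v \<in> pverts (cat k z)"
  shows "out_degree (with_proj (cat k z)) v =
    (if snd v = 0 \<and> 1 \<le> fst v \<and> fst v \<le> k then z (fst v) + 2 else 1)"
proof -
  obtain j i where v: "v = (j, i)" by (cases v)
  let ?N = "{w. (v, w) \<in> parcs (cat k z)}"
  have "out_arcs (with_proj (cat k z)) v = Pair v ` ?N"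
    by (auto simp: out_arcs_def)
  then have deg: "out_degree (with_proj (cat k z)) v = card ?N"
    by (simp add: out_degree_def card_image inj_on_def)
  consider (inner) "i = 0" "1 \<le> j" "j \<le> k" | (first) "i = 0" "j = 0" | (last) "i = 0" "j = k + 1"
    | (leaf) "i \<noteq> 0" "1 \<le> j" "j \<le> k" "1 \<le> i" "i \<le> z j"
    using assms by (cases "j = 0") (auto simp: v pverts_cat spine_def leaves_def le_Suc_eq)
  then show ?thesis
  proof cases
    case inner
    then have "?N = insert (j - 1, 0) (insert (j + 1, 0) (Pair j ` {1..z j}))"
      by (auto simp: v parcs_cat cat_edges_iff)
    moreover have "(j - 1, 0) \<notin> insert (j + 1, 0) (Pair j ` {1..z j})"
      "(j + 1, 0) \<notin> Pair j ` {1..z j}" by auto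
    moreover have "card (Pair j ` {1..z j}) = z j" by (simp add: card_image inj_on_def)
    ultimately have "card ?N = z j + 2" by simp
    then show ?thesis using deg inner by (simp add: v)
  next
    case first
    then have "?N = {(1, 0)}" by (auto simp: v parcs_cat cat_edges_iff)
    then show ?thesis using deg first by (simp add: v)
  next
    case last
    then have "?N = {(k, 0)}" by (auto simp: v parcs_cat cat_edges_iff)
    then show ?thesis using deg last by (simp add: v)
  next
    case leaf
    then have "?N = {(j, 0)}" by (auto simp: v parcs_cat cat_edges_iff)
    then show ?thesis using deg leaf by (simp add: v)
  qed
qed

text \<open>Moving each spine vertex together with its pendant vertices from position
  \<open>j\<close> to \<open>\<tau> j\<close> is a bijection of the vertex sets. It need not
  preserve adjacency, but it preserves degrees.\<close>

lemma has_degree_sequence_cat_permuted: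
  assumes "has_degree_sequence (cat k z) ds" "\<tau> permutes {1..k}" "\<And>j. z' (\<tau> j) = z j"
  shows "has_degree_sequence (cat k z') ds"
proof -
  have \<tau>_range: "\<tau> j \<in> {1..k} \<longleftrightarrow> j \<in> {1..k}" for j
    using permutes_in_image[OF assms(2)] by simp
  have \<tau>_out: "\<tau> j = j" if "j \<notin> {1..k}" for j using permutes_not_in[OF assms(2) that] .
  let ?f = "map_prod \<tau> id :: nat \<times> nat \<Rightarrow> nat \<times> nat"
  have "inj ?f" using permutes_inj[OF assms(2)] by (simp add: prod.inj_map)
  have V: "pverts (cat k z') = ?f ` pverts (cat k z)"
  proof -
    have "spine 0 (k + 1) = ?f ` spine 0 (k + 1)"
    proof -
      \<comment> \<open>The ends \<open>0\<close> and \<open>k + 1\<close> are fixed.\<close>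
      have "\<tau> permutes {0..k + 1}" by (rule permutes_subset[OF assms(2)]) auto
      then have "\<tau> ` {0..k + 1} = {0..k + 1}" by (rule permutes_image)
      moreover have "?f ` spine 0 (k + 1) = (\<tau> ` {0..k + 1}) \<times> {0}"
        by (simp add: spine_def map_prod_def image_paired_Times)
      ultimately show ?thesis by (simp add: spine_def)
    qed
    moreover have "leaves k z' 0 (k + 1) = ?f ` leaves k z 0 (k + 1)"
    proof (intro equalityI subsetI)
      fix v assume "v \<in> leaves k z' 0 (k + 1)"
      then obtain j i where v: "v = (j, i)" "j \<in> {1..k}" "i \<in> {1..z' j}" by (auto simp: leaves_def)
      from v(2) obtain j' where j': "j = \<tau> j'" using permutes_surj[OF assms(2)] by (metis surjD)
      with v \<tau>_range assms(3) have "(j', i) \<in> leaves k z 0 (k + 1)" by (auto simp: leaves_def)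
      then show "v \<in> ?f ` leaves k z 0 (k + 1)" using v(1) j' by (force simp: image_iff)
    next
      fix v assume "v \<in> ?f ` leaves k z 0 (k + 1)"
      then show "v \<in> leaves k z' 0 (k + 1)"
        using \<tau>_range assms(3) by (fastforce simp: leaves_def)
    qed
    ultimately show ?thesis unfolding pverts_cat image_Un by simp
  qed
  have deg: "out_degree (with_proj (cat k z')) (?f v) = out_degree (with_proj (cat k z)) v"
    if "v \<in> pverts (cat k z)" for v
  proof -
    have "?f v \<in> pverts (cat k z')" using V that by blast
    then show ?thesis
      using that \<tau>_range[of "fst v"] assms(3)[of "fst v"] by (auto simp: out_degree_cat)
  qed
  have "image_mset (out_degree (with_proj (cat k z'))) (mset_set (pverts (cat k z'))) =
    image_mset (out_degree (with_proj (cat k z'))) (image_mset ?f (mset_set (pverts (cat k z))))"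
    unfolding V using \<open>inj ?f\<close> by (subst image_mset_mset_set) (auto intro: inj_on_subset)
  also have "\<dots> = image_mset (out_degree (with_proj (cat k z))) (mset_set (pverts (cat k z)))"
  proof -
    have "finite (pverts (cat k z))" by (simp add: pverts_cat spine_def)
    then show ?thesis
      unfolding multiset.map_comp by (intro image_mset_cong) (auto simp: deg)
  qed
  finally show ?thesis using assms(1) by (simp add: has_degree_sequence_def)
qed

subsection \<open>Counting subtrees by weighted intervals\<close>

definition weight :: "nat \<Rightarrow> (nat \<Rightarrow> nat) \<Rightarrow> nat \<Rightarrow> nat" where
  "weight k z j = (if j \<in> {1..k} then 2 ^ z j else 1)"

definition interval_sum :: "(nat \<Rightarrow> nat) \<Rightarrow> nat \<Rightarrow> nat" where
  "interval_sum y n = (\<Sum>(a, b)\<in>(SIGMA a:{0..n}. {a..n}). \<Prod>j\<in>{a..b}. y j)"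

text \<open>The pendant vertices at different spine positions are chosen independently, which gives
  the product.\<close>

lemma card_Pow_leaves: "card (Pow (leaves k z a b)) = (\<Prod>j\<in>{a..b}. weight k z j)"
proof -
  have "card (leaves k z a b) = (\<Sum>j\<in>{a..b} \<inter> {1..k}. z j)"
    by (simp add: leaves_def)
  then have "card (Pow (leaves k z a b)) = (\<Prod>j\<in>{a..b} \<inter> {1..k}. 2 ^ z j)"
    by (simp add: card_Pow power_sum)
  also have "\<dots> = (\<Prod>j\<in>{a..b}. weight k z j)"
    unfolding weight_def by (rule prod.inter_restrict) simp
  finally show ?thesis .
qed

lemma num_subtrees_cat:
  "num_subtrees (cat k z) = (\<Sum>j\<in>{1..k}. z j) + interval_sum (weight k z) (k + 1)"
proof -
  let ?I = "SIGMA ab:(SIGMA a:{0..k + 1}. {a..k + 1}). Pow (leaves k z (fst ab) (snd ab))"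
  let ?g = "\<lambda>(ab, L). spine (fst ab) (snd ab) \<union> L"
  have verts: "subtree_verts k z = (\<lambda>v. {v}) ` leaves k z 1 k \<union> ?g ` ?I"
  proof -
    have "{spine a b \<union> L | a b L. a \<le> b \<and> b \<le> k + 1 \<and> L \<subseteq> leaves k z a b} = ?g ` ?I"
    proof (intro equalityI subsetI)
      fix S assume "S \<in> {spine a b \<union> L | a b L. a \<le> b \<and> b \<le> k + 1 \<and> L \<subseteq> leaves k z a b}"
      then obtain a b L where "S = ?g ((a, b), L)" "((a, b), L) \<in> ?I" by auto
      then show "S \<in> ?g ` ?I" by (rule image_eqI)
    next
      fix S assume "S \<in> ?g ` ?I"
      then obtain x where "x \<in> ?I" "S = ?g x" by (rule imageE)
      moreover obtain a b L where "x = ((a, b), L)" by (metis prod.exhaust)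
      ultimately have "S = spine a b \<union> L" "a \<le> b" "b \<le> k + 1" "L \<subseteq> leaves k z a b" by auto
      then show "S \<in> {spine a b \<union> L | a b L. a \<le> b \<and> b \<le> k + 1 \<and> L \<subseteq> leaves k z a b}" by auto
    qed
    then show ?thesis by (simp only: subtree_verts_def)
  qed
  have "inj_on ?g ?I"
  proof (rule inj_onI)
    fix x x' assume x: "x \<in> ?I" and x': "x' \<in> ?I" and eq: "?g x = ?g x'"
    obtain a b L where x_eq: "x = ((a, b), L)" by (metis prod.exhaust)
    obtain a' b' L' where x'_eq: "x' = ((a', b'), L')" by (metis prod.exhaust)
    have L: "L \<subseteq> leaves k z a b" "L' \<subseteq> leaves k z a' b'" and ab: "a \<le> b" "a' \<le> b'"
      using x x' by (auto simp: x_eq x'_eq)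
    have eq: "spine a b \<union> L = spine a' b' \<union> L'" using eq by (simp add: x_eq x'_eq)
    \<comment> \<open>Spine vertices have second coordinate 0 and pendant vertices do not, so the
      union determines both the interval and the pendant set.\<close>
    have split: "(spine c d \<union> M) \<inter> UNIV \<times> {0} = spine c d" "(spine c d \<union> M) - UNIV \<times> {0} = M"
      if "M \<subseteq> leaves k z c d" for c d M
      using that by (auto simp: spine_def leaves_def)
    have "spine a b = spine a' b'" "L = L'"
      using split[of L a b] split[of L' a' b'] L eq by metis+
    moreover from this(1) have "fst ` spine a b = fst ` spine a' b'" by (rule arg_cong)
    then have "{a..b} = {a'..b'}" by (simp add: spine_def)
    with ab have "a = a'" "b = b'" by (auto simp: Icc_eq_Icc)
    ultimately show "x = x'" by (simp add: x_eq x'_eq)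
  qed
  then have "card (?g ` ?I) = card ?I" by (rule card_image)
  also have "\<dots> = interval_sum (weight k z) (k + 1)"
    by (simp add: interval_sum_def card_Pow_leaves card_SigmaI case_prod_beta)
  finally have cI: "card (?g ` ?I) = interval_sum (weight k z) (k + 1)" .
  have cL: "card ((\<lambda>v. {v}) ` leaves k z 1 k) = (\<Sum>j\<in>{1..k}. z j)"
    by (simp add: card_image leaves_def)
  \<comment> \<open>The two families are disjoint because every set of the second contains a spine
    vertex.\<close>
  have "(\<lambda>v. {v}) ` leaves k z 1 k \<inter> ?g ` ?I = {}"
  proof -
    have single: "v \<notin> leaves k z 1 k" if "x \<in> ?I" "?g x = {v}" for x v
    proof -
      obtain a b L where x: "x = ((a, b), L)" by (metis prod.exhaust)
      with that(1) have "(a, 0) \<in> ?g x" by (simp add: spine_def)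
      with that(2) have "(a, 0) \<in> {v}" by (simp only:)
      then show ?thesis by (auto simp: leaves_def)
    qed
    show ?thesis
    proof (rule equals0I)
      fix S assume S: "S \<in> (\<lambda>v. {v}) ` leaves k z 1 k \<inter> ?g ` ?I"
      obtain v where v: "v \<in> leaves k z 1 k" "S = {v}" using S by (elim IntE imageE)
      obtain x where x: "x \<in> ?I" "S = ?g x" using S by (elim IntE imageE)
      have "?g x = {v}" using v(2) x(2) by (simp only:)
      from single[OF x(1) this] v(1) show False by contradiction
    qed
  qed
  then have "card (subtree_verts k z) = (\<Sum>j\<in>{1..k}. z j) + interval_sum (weight k z) (k + 1)"
    unfolding verts using cI cL by (subst card_Un_disjoint) auto
  moreover have "inj_on (cat_induced k z) (subtree_verts k z)"
    by (rule inj_onI) (metis cat_induced_def pair_pre_digraph.select_convs(1))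
  ultimately show ?thesis by (simp add: num_subtrees_def subtrees_cat card_image)
qed

subsection \<open>Exchanging neighbouring weights\<close>

definition left_sum :: "(nat \<Rightarrow> nat) \<Rightarrow> nat \<Rightarrow> nat" where
  "left_sum y p = (\<Sum>a\<in>{..<p}. \<Prod>j\<in>{a..<p}. y j)"

definition right_sum :: "(nat \<Rightarrow> nat) \<Rightarrow> nat \<Rightarrow> nat \<Rightarrow> nat" where
  "right_sum y n p = (\<Sum>b\<in>{p<..n}. \<Prod>j\<in>{p<..b}. y j)"

text \<open>An interval ending at \<open>p\<close> is either \<open>p\<close> alone or extends an
  interval ending just before \<open>p\<close>; \<open>right_sum_step\<close> is the mirror
  image.\<close>

lemma left_sum_Suc: "left_sum y (Suc p) = y p * (1 + left_sum y p)"
proof -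
  have "left_sum y (Suc p) = (\<Sum>a\<in>{..<p}. \<Prod>j\<in>{a..<Suc p}. y j) + y p"
    by (simp add: left_sum_def)
  also have "(\<Sum>a\<in>{..<p}. \<Prod>j\<in>{a..<Suc p}. y j) = (\<Sum>a\<in>{..<p}. y p * (\<Prod>j\<in>{a..<p}. y j))"
    by (rule sum.cong) (auto simp: mult.commute)
  finally show ?thesis by (simp add: left_sum_def sum_distrib_left algebra_simps)
qed

lemma right_sum_step:
  assumes "p < n"
  shows "right_sum y n p = y (Suc p) * (1 + right_sum y n (Suc p))"
proof -
  have "{p<..n} = insert (Suc p) {Suc p<..n}" using assms by auto
  then have "right_sum y n p = y (Suc p) + (\<Sum>b\<in>{Suc p<..n}. \<Prod>j\<in>{p<..b}. y j)"
  proof -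
    have "{p<..Suc p} = {Suc p}" by auto
    with \<open>{p<..n} = insert (Suc p) {Suc p<..n}\<close> show ?thesis by (simp add: right_sum_def)
  qed
  also have "(\<Sum>b\<in>{Suc p<..n}. \<Prod>j\<in>{p<..b}. y j) = (\<Sum>b\<in>{Suc p<..n}. y (Suc p) * (\<Prod>j\<in>{Suc p<..b}. y j))"
  proof (rule sum.cong)
    fix b assume "b \<in> {Suc p<..n}"
    then have "{p<..b} = insert (Suc p) {Suc p<..b}" by auto
    then show "(\<Prod>j\<in>{p<..b}. y j) = y (Suc p) * (\<Prod>j\<in>{Suc p<..b}. y j)" by simp
  qed simp
  finally show ?thesis by (simp add: right_sum_def sum_distrib_left algebra_simps)
qed

lemma left_sum_strict_mono:
  assumes "\<And>j. 1 \<le> y j" "p < q"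
  shows "left_sum y p < left_sum y q"
  using \<open>p < q\<close>
proof (rule lift_Suc_mono_less[rotated])
  fix m
  show "left_sum y m < left_sum y (Suc m)"
    using mult_le_mono1[OF assms(1)[of m], of "1 + left_sum y m"] by (simp add: left_sum_Suc)
qed

lemma right_sum_antimono:
  assumes "\<And>j. 1 \<le> y j" "p \<le> q" "q \<le> n"
  shows "right_sum y n q \<le> right_sum y n p"
  using assms(2,3)
proof (induction rule: dec_induct)
  case (step m)
  have "right_sum y n (Suc m) \<le> right_sum y n m"
    using mult_le_mono1[OF assms(1)[of "Suc m"], of "1 + right_sum y n (Suc m)"] step
    by (simp add: right_sum_step)
  with step show ?case by simp
qed simp

text \<open>The intervals ending at \<open>p\<close> or starting at \<open>Suc p\<close> are exactly
  those containing one of \<open>p\<close> and \<open>Suc p\<close> but not the other, hence the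
  only ones whose product an exchange can change.\<close>

lemma interval_sum_split:
  assumes "p < n"
  shows "interval_sum y n = left_sum y (Suc p) + right_sum y n p +
    (\<Sum>(a, b)\<in>{(a, b). a \<le> b \<and> b \<le> n \<and> b \<noteq> p \<and> a \<noteq> Suc p}. \<Prod>j\<in>{a..b}. y j)"
proof -
  let ?f = "\<lambda>(a, b). \<Prod>j\<in>{a..b}. y j"
  let ?L = "(\<lambda>a. (a, p)) ` {..<Suc p}" and ?R = "Pair (Suc p) ` {p<..n}"
  let ?O = "{(a, b). a \<le> b \<and> b \<le> n \<and> b \<noteq> p \<and> a \<noteq> Suc p}"
  have I: "(SIGMA a:{0..n}. {a..n}) = (?L \<union> ?R) \<union> ?O" using assms by auto
  have "finite (SIGMA a:{0..n}. {a..n})" by simp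
  then have "finite ?O" unfolding I by (simp only: finite_Un)
  then have "sum ?f ((?L \<union> ?R) \<union> ?O) = sum ?f (?L \<union> ?R) + sum ?f ?O"
    by (intro sum.union_disjoint) auto
  also have "sum ?f (?L \<union> ?R) = sum ?f ?L + sum ?f ?R"
    by (intro sum.union_disjoint) auto
  also have "sum ?f ?L = left_sum y (Suc p)"
    by (subst sum.reindex) (auto simp: inj_on_def left_sum_def atLeastLessThanSuc_atLeastAtMost)
  also have "sum ?f ?R = right_sum y n p"
    by (subst sum.reindex) (auto simp: inj_on_def right_sum_def atLeastSucAtMost_greaterThanAtMost)
  finally show ?thesis by (simp add: interval_sum_def I)
qed

text \<open>The formula for the change of the interval sum, with the negative terms moved across the
  equation to avoid subtraction of natural numbers.\<close>

lemma interval_sum_swap: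
  fixes y :: "nat \<Rightarrow> nat"
  assumes "p < n"
  defines "y' \<equiv> y \<circ> Transposition.transpose p (Suc p)"
  shows "interval_sum y' n + y p * left_sum y p + y (Suc p) * right_sum y n (Suc p) =
    interval_sum y n + y (Suc p) * left_sum y p + y p * right_sum y n (Suc p)"
proof -
  let ?\<tau> = "Transposition.transpose p (Suc p)"
  \<comment> \<open>Such an interval contains both exchanged positions or neither, so its factors
    are permuted or unchanged.\<close>
  have "(\<Prod>j\<in>{a..b}. y' j) = (\<Prod>j\<in>{a..b}. y j)" if "b \<noteq> p" "a \<noteq> Suc p" for a b
  proof (cases "p \<in> {a..b}")
    case True
    with that have "?\<tau> permutes {a..b}" by (intro permutes_swap_id) auto
    from prod.permute[OF this, of y] show ?thesis by (simp add: y'_def)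
  next
    case False
    with that have "?\<tau> j = j" if "j \<in> {a..b}" for j
      using that by (auto simp: transpose_def)
    then show ?thesis by (simp add: y'_def)
  qed
  then have other: "(\<Sum>(a, b)\<in>{(a, b). a \<le> b \<and> b \<le> n \<and> b \<noteq> p \<and> a \<noteq> Suc p}. \<Prod>j\<in>{a..b}. y' j) =
    (\<Sum>(a, b)\<in>{(a, b). a \<le> b \<and> b \<le> n \<and> b \<noteq> p \<and> a \<noteq> Suc p}. \<Prod>j\<in>{a..b}. y j)"
    by (intro sum.cong) auto
  have y'_eq: "y' j = y j" if "j \<noteq> p" "j \<noteq> Suc p" for j
    using that by (auto simp: y'_def transpose_def)
  have y'_swap: "y' p = y (Suc p)" "y' (Suc p) = y p"
    by (auto simp: y'_def)
  have "left_sum y' p = left_sum y p"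
    unfolding left_sum_def by (intro sum.cong prod.cong y'_eq) auto
  moreover have "right_sum y' n (Suc p) = right_sum y n (Suc p)"
    unfolding right_sum_def by (intro sum.cong prod.cong y'_eq) auto
  ultimately have "left_sum y' (Suc p) = y (Suc p) * (1 + left_sum y p)"
    "right_sum y' n p = y p * (1 + right_sum y n (Suc p))"
    using y'_swap by (simp_all add: left_sum_Suc right_sum_step[OF assms(1)])
  then show ?thesis
    by (simp add: interval_sum_split[OF assms(1)] left_sum_Suc right_sum_step[OF assms(1)]
        other algebra_simps)
qed

text \<open>The exchanged caterpillar is a competitor with as many pendant vertices, so optimality
  compares the interval sums alone. The order of the weights is that of the exponents.\<close>

lemma optimal_adjacent:
  fixes z :: "nat \<Rightarrow> nat" and k :: nat
  defines "y \<equiv> weight k z"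
  assumes opt: "maximum_optimal_caterpillar ds (cat k z)" and p: "1 \<le> p" "p < k"
  shows "right_sum y (k + 1) (Suc p) < left_sum y p \<Longrightarrow> z (Suc p) \<le> z p"
    and "left_sum y p < right_sum y (k + 1) (Suc p) \<Longrightarrow> z p \<le> z (Suc p)"
proof -
  let ?\<tau> = "Transposition.transpose p (Suc p)"
  let ?z = "z \<circ> ?\<tau>" and ?l = "left_sum y p" and ?r = "right_sum y (k + 1) (Suc p)"
  have perm: "?\<tau> permutes {1..k}" using p by (intro permutes_swap_id) auto
  have "has_degree_sequence (cat k z) ds"
    using opt by (simp add: maximum_optimal_caterpillar_def caterpillars_def)
  then have "has_degree_sequence (cat k ?z) ds"
    using perm by (rule has_degree_sequence_cat_permuted) simp
  then have "num_subtrees (cat k ?z) \<le> num_subtrees (cat k z)"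
    using opt is_caterpillar_cat by (simp add: maximum_optimal_caterpillar_def caterpillars_def)
  moreover have "(\<Sum>j\<in>{1..k}. ?z j) = (\<Sum>j\<in>{1..k}. z j)"
    using sum.permute[OF perm, of z] by simp
  moreover have "weight k ?z = y \<circ> ?\<tau>"
    using permutes_in_image[OF perm] by (auto simp: fun_eq_iff weight_def y_def)
  ultimately have "interval_sum (y \<circ> ?\<tau>) (k + 1) \<le> interval_sum y (k + 1)"
    by (simp add: num_subtrees_cat y_def)
  then have le: "y (Suc p) * ?l + y p * ?r \<le> y p * ?l + y (Suc p) * ?r"
    using interval_sum_swap[of p "k + 1" y] p by simp
  have y: "y p = 2 ^ z p" "y (Suc p) = 2 ^ z (Suc p)" using p by (auto simp: y_def weight_def)
  \<comment> \<open>With \<open>l = r + d\<close> the inequality reduces to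
    \<open>b * d \<le> a * d\<close>, and \<open>d\<close> is positive.\<close>
  have rearrange: "b \<le> a" if "b * l + a * r \<le> a * l + b * r" "r < l" for a b l r :: nat
  proof -
    from \<open>r < l\<close> obtain d where "l = r + d" "0 < d" by (metis less_imp_add_positive)
    with that(1) show ?thesis by (simp add: algebra_simps)
  qed
  show "z (Suc p) \<le> z p" if "?r < ?l"
    using rearrange[OF le that] y by simp
  show "z p \<le> z (Suc p)" if "?l < ?r"
    using rearrange[of "y p" ?r "y (Suc p)" ?l] le that y by (simp add: add.commute)
qed

section \<open>The peak of an optimal caterpillar\<close>

theorem theorem3p5:
  fixes n k :: nat and d z \<sigma> :: "nat \<Rightarrow> nat"
  assumes "\<exists>T :: (nat \<times> nat) pair_pre_digraph. is_tree T \<and> has_degree_sequence T (map d [1..<n+1])"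
    and "3 \<le> k" and "k \<le> n"
    and "\<forall>i\<in>{1..<k}. d i \<ge> d (i + 1)" and "d k \<ge> 2"
    and "\<forall>i\<in>{k+1..n}. d i = 1"
    and "\<sigma> permutes {1..k}" and "\<forall>j\<in>{1..k}. z j = d (\<sigma> j) - 2"
    and "maximum_optimal_caterpillar (map d [1..<n+1]) (cat k z)"
  shows "\<exists>t. 1 \<le> t \<and> t \<le> k - 1 \<and>
           (\<forall>j. 1 \<le> j \<and> j + 1 \<le> t - 1 \<longrightarrow> z j \<le> z (j + 1)) \<and>
           (2 \<le> t \<longrightarrow> z (t - 1) < z t) \<and>
           (\<forall>j. t \<le> j \<and> j + 1 \<le> k \<longrightarrow> z j \<ge> z (j + 1))"
proof -
  let ?y = "weight k z"
  let ?l = "left_sum ?y" and ?r = "\<lambda>p. right_sum ?y (k + 1) (Suc p)"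
  have y: "1 \<le> ?y j" for j by (simp add: weight_def)
  note adj = optimal_adjacent[OF assms(9)]
  let ?dec = "\<lambda>t. 1 \<le> t \<and> (\<forall>j. t \<le> j \<and> j < k \<longrightarrow> z (Suc j) \<le> z j)"
  have "?dec (k - 1)"
  proof -
    \<comment> \<open>Only \<open>v\<^sub>k\<^sub>+\<^sub>1\<close> lies after
      \<open>v\<^sub>k\<close> and only \<open>v\<^sub>0\<close> before \<open>v\<^sub>1\<close>,
      both of weight 1. Strictness below needs \<open>1 < k - 1\<close>, which is where
      \<open>3 \<le> k\<close> enters.\<close>
    have "?r (k - 1) = 1"
      using \<open>3 \<le> k\<close> by (simp add: right_sum_step weight_def) (simp add: right_sum_def)
    also have "1 = ?l 1"
      using left_sum_Suc[of ?y 0] by (simp add: weight_def left_sum_def)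
    also have "\<dots> < ?l (k - 1)"
      using \<open>3 \<le> k\<close> by (intro left_sum_strict_mono[OF y]) simp
    finally have "z (Suc (k - 1)) \<le> z (k - 1)"
      using adj(1)[of "k - 1"] \<open>3 \<le> k\<close> by simp
    have "z (Suc j) \<le> z j" if "k - 1 \<le> j \<and> j < k" for j
    proof -
      from that have "j = k - 1" by arith
      with \<open>z (Suc (k - 1)) \<le> z (k - 1)\<close> show ?thesis by (simp only:)
    qed
    with \<open>3 \<le> k\<close> show ?thesis by auto
  qed
  define t where "t = (LEAST t. ?dec t)"
  have dec: "?dec t" unfolding t_def by (rule LeastI) (rule \<open>?dec (k - 1)\<close>)
  have least: "t \<le> u" if "?dec u" for u unfolding t_def using that by (rule Least_le)
  have "t \<le> k - 1" using \<open>?dec (k - 1)\<close> by (rule least)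
  \<comment> \<open>Without an ascent into \<open>t\<close>, the index \<open>t - 1\<close> would
    satisfy \<open>?dec\<close> as well, against minimality.\<close>
  have ascent: "z (t - 1) < z t" if "2 \<le> t"
  proof (rule ccontr)
    assume no: "\<not> z (t - 1) < z t"
    have "?dec (t - 1)"
    proof (intro conjI allI impI)
      fix j assume "t - 1 \<le> j \<and> j < k"
      with no that dec show "z (Suc j) \<le> z j" by (cases "j = t - 1") auto
    qed (use that in simp)
    then have "t \<le> t - 1" by (rule least)
    with that show False by simp
  qed
  have "z j \<le> z (Suc j)" if "1 \<le> j" "j + 1 \<le> t - 1" for j
  proof -
    from that \<open>t \<le> k - 1\<close> have t: "2 \<le> t" "t - 1 < k" "j < t - 1" "Suc (t - 1) = t" by linarith+
    \<comment> \<open>The ascent into \<open>t\<close> gives only a weak inequality between the two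
      sums at \<open>t - 1\<close>. Moving left to \<open>j\<close> lowers the left sum strictly and
      does not lower the right sum, so the inequality becomes strict there.\<close>
    have "\<not> ?r (t - 1) < ?l (t - 1)"
    proof
      assume "?r (t - 1) < ?l (t - 1)"
      with adj(1)[of "t - 1"] t have "z t \<le> z (t - 1)" by simp
      with ascent[OF t(1)] show False by simp
    qed
    moreover have "?l j < ?l (t - 1)"
      by (rule left_sum_strict_mono[OF y t(3)])
    moreover have "?r (t - 1) \<le> ?r j"
      using t by (intro right_sum_antimono[OF y]) linarith+
    ultimately have "?l j < ?r j" by simp
    then show ?thesis using adj(2)[of j] that(1) t by simp
  qed
  then show ?thesis using dec ascent \<open>t \<le> k - 1\<close> by (intro exI[of _ t]) auto
qed

end
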